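(* Let $1\le p<2<u\le\infty$ and let $c(0)\in(0,1)$ be the constant described in the context. For $n,N_1,N_2\in\mathbb{N}$ with $N_1\le n<c(0)N_1N_2$ put $$\gamma(p,u,n,N_1,N_2)=\frac{e_n^{\mathrm{ran-non}}\big(I^{N_1,N_2},B_{L_p^{N_1}(L_u^{N_2})}\big)}{e_n^{\mathrm{ran}}\big(I^{N_1,N_2},B_{L_p^{N_1}(L_u^{N_2})}\big)},\qquad \gamma(p,u,n)=\sup_{N_1,N_2:\,N_1\le n<c(0)N_1N_2}\gamma(p,u,n,N_1,N_2).$$ Then there are constants $c_1,c_2>0$ such that for all $n\in\mathbb{N}$ $$c_1(\log(n+1))^{1/u-1}\,n^{\frac{\left(\frac1p-\frac12\right)\left(\frac12-\frac1u\right)}{\frac1p-\frac1u}}\le\gamma(p,u,n)\le c_2\,n^{\frac{\left(\frac1p-\frac12\right)\left(\frac12-\frac1u\right)}{\frac1p-\frac1u}}.$$ The exponent of $n$, as a function of $(p,u)$ with $1\le p<2<u\le\infty$, attains its maximal value $1/4$ if and only if $p=1$, $u=\infty$. In this case ($p=1$, $u=\infty$) the following holds: for any constants $c_3,c_4$ with $c(0)^{-1/2}<c_3<c_4$ there are constants $c_5,c_6>0$ such that for all $n\in\mathbb{N}$ with $n\ge c_4^2$ and all $N_1,N_2\in\mathbb{N}\cap[c_3n^{1/2},c_4n^{1/2}]$ $$c_5(\log(n+1))^{-1}n^{1/4}\le\frac{e_n^{\mathrm{ran-non}}\big(I^{N_1,N_2},B_{L_1^{N_1}(L_\infty^{N_2})}\big)}{e_n^{\mathrm{ran}}\big(I^{N_1,N_2},B_{L_1^{N_1}(L_\infty^{N_2})}\big)}\le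 c_6n^{1/4}.$$
   Context: $\mathbb{N}=\{1,2,\dots\}$, $\mathbb{N}_0=\mathbb{N}\cup\{0\}$, $\mathbb{K}\in\{\mathbb{R},\mathbb{C}\}$, $\log=\log_2$, $1/\infty=0$, $B_X$ is the closed unit ball of a normed space $X$. Spaces and problem. For $N\in\mathbb{N}$, $1\le p\le\infty$, $L_p^N$ is the space of functions $f:\{1,\dots,N\}\to\mathbb{K}$ with norm $\big(\frac1N\sum_{i=1}^N|f(i)|^p\big)^{1/p}$ if $p<\infty$ and $\max_i|f(i)|$ if $p=\infty$. $L_p^{N_1}(L_u^{N_2})$ is the space of all $f:\{1,\dots,N_1\}\times\{1,\dots,N_2\}\to\mathbb{K}$ with norm $\big\|(\|f_i\|_{L_u^{N_2}})_{i=1}^{N_1}\big\|_{L_p^{N_1}}$, where $f_i=(f(i,j))_{j=1}^{N_2}$. The mean operator is $I^{N_1,N_2}f=\frac1{N_1N_2}\sum_{i=1}^{N_1}\sum_{j=1}^{N_2}f(i,j)$. The numerical problem considered is $(F,G,S,K,\Lambda)$ with $F=B_{L_p^{N_1}(L_u^{N_2})}$, $G=K=\mathbb{K}$, $S=I^{N_1,N_2}$, $\Lambda=\{\delta_{ij}:1\le i\le N_1,1\le j\le N_2\}$, $\delta_{ij}(f)=f(i,j)$ (standard information). Algorithms and minimal errors. A numerical problem is a tuple $(F,G,S,K,\Lambda)$: $F$ a nonempty set, $G$ a Banach space, $S:F\to G$ a map, $K$ a nonempty set, $\Lambda$ a nonempty set of maps $F\to K$. A deterministic algorithm is a tuple $A=((L_i)_{i\ge1},(\tau_i)_{i\ge0},(\varphi_i)_{i\ge0})$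 with $L_1\in\Lambda$, $\tau_0\in\{0,1\}$, $\varphi_0\in G$ and arbitrary maps $L_{i+1}:K^i\to\Lambda$, $\tau_i:K^i\to\{0,1\}$, $\varphi_i:K^i\to G$ $(i\ge1)$. For $f\in F$ let $\lambda_1=L_1$, $\lambda_i=L_i(\lambda_1(f),\dots,\lambda_{i-1}(f))$ $(i\ge2)$. $\mathrm{card}(A,f)$ is the smallest $n\ge0$ with $\tau_n(\lambda_1(f),\dots,\lambda_n(f))=1$ (for $n=0$: $\tau_0=1$), and $\infty$ if there is none. The output is $A(f)=\varphi_n(\lambda_1(f),\dots,\lambda_n(f))$ if $n=\mathrm{card}(A,f)<\infty$ (with $A(f)=\varphi_0$ for $n=0$) and $A(f)=\varphi_0$ if $\mathrm{card}(A,f)=\infty$. $A$ is non-adaptive if all $L_i$ and all $\tau_i$ are constant. A randomized algorithm is $A=((\Omega,\Sigma,\mathbb{P}),(A_\omega)_{\omega\in\Omega})$ with $(\Omega,\Sigma,\mathbb{P})$ a probability space and each $A_\omega$ a deterministic algorithm, such that for every $f\in F$ the map $\omega\mapsto\mathrm{card}(A_\omega,f)$ is measurable and $\omega\mapsto A_\omega(f)$ is Borel measurable and almost surely separably valued; it is non-adaptive if every $A_\omega$ is. For $n\in\mathbb{N}_0$, $e_n^{\mathrm{ran}}(S,F,G)$ (resp. $e_n^{\mathrm{ran-non}}(S,F,G)$) is the infimum of $\sup_{f\in F}\mathbb{E}\|S(f)-A_\omega(f)\|_G$ over all (resp. all non-adaptive) randomized algorithms with $\sup_{f\in F}\mathbb{E}\,\mathrm{card}(A_\omega,f)\le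 n$. If $G=\mathbb{K}$, $G$ is omitted from the notation. The constant $c(0)$. For given $1\le p<2<u\le\infty$, $c(0)\in(0,1)$ denotes a constant (such a constant exists) for which there are $a_1,a_2,a_3,a_4>0$ such that for all $n,N_1,N_2\in\mathbb{N}$ with $N_1\le n<c(0)N_1N_2$, writing $I=I^{N_1,N_2}$, $B=B_{L_p^{N_1}(L_u^{N_2})}$, $$a_1N_1^{1/p-1/u}n^{-1+1/u}+a_1n^{-1/2}\le e_n^{\mathrm{ran}}(I,B)\le a_2N_1^{1/p-1/u}n^{-1+1/u}(\log(N_1+1))^{1-1/u}+a_2n^{-1/2}(\log(N_1+1))^{1/2},$$ $$a_3N_1^{1/p-1/2}n^{-1/2}\le e_n^{\mathrm{ran-non}}(I,B)\le a_4N_1^{1/p-1/2}n^{-1/2}.$$ *)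

theory Defs
  imports "HOL-Analysis.Analysis"
begin

section \<open>Deterministic algorithms\<close>

text \<open>
  A deterministic algorithm for a problem with inputs in \<open>'f\<close>, information values in \<open>'k\<close> and
  solutions in \<open>'g\<close>. The families \<open>L\<^sub>i\<^sub>+\<^sub>1\<close>, \<open>\<tau>\<^sub>i\<close>, \<open>\<phi>\<^sub>i\<close> of maps on \<open>i\<close>-tuples (\<open>i \<ge> 0\<close>) are merged
  into single maps on lists, whose restriction to lists of length \<open>i\<close> is the member of index \<open>i\<close>;
  \<open>L\<^sub>1\<close>, \<open>\<tau>\<^sub>0\<close>, \<open>\<phi>\<^sub>0\<close> are the values at the empty list. \<open>stop_at A xs\<close> means \<open>\<tau>\<^sub>i(xs) = 1\<close>.
\<close>

datatype ('f, 'k, 'g) det_alg =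
  Det_Alg (query: "'k list \<Rightarrow> 'f \<Rightarrow> 'k") (stop_at: "'k list \<Rightarrow> bool") (out: "'k list \<Rightarrow> 'g")

definition det_algorithm :: "('f \<Rightarrow> 'k) set \<Rightarrow> ('f, 'k, 'g) det_alg \<Rightarrow> bool" where
  "det_algorithm \<Lambda> A \<longleftrightarrow> (\<forall>xs. query A xs \<in> \<Lambda>)"

definition nonadaptive :: "('f, 'k, 'g) det_alg \<Rightarrow> bool" where
  "nonadaptive A \<longleftrightarrow>
     (\<forall>xs ys. length xs = length ys \<longrightarrow> query A xs = query A ys \<and> stop_at A xs = stop_at A ys)"

text \<open>\<open>info_values A f n\<close> is the list \<open>[\<lambda>\<^sub>1(f), \<dots>, \<lambda>\<^sub>n(f)]\<close>.\<close>

primrec info_values :: "('f, 'k, 'g) det_alg \<Rightarrow> 'f \<Rightarrow> nat \<Rightarrow> 'k list" where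
  "info_values A f 0 = []"
| "info_values A f (Suc n) = info_values A f n @ [query A (info_values A f n) f]"

definition alg_card :: "('f, 'k, 'g) det_alg \<Rightarrow> 'f \<Rightarrow> enat" where
  "alg_card A f =
     (if \<exists>n. stop_at A (info_values A f n)
      then enat (LEAST n. stop_at A (info_values A f n)) else \<infinity>)"

definition alg_output :: "('f, 'k, 'g) det_alg \<Rightarrow> 'f \<Rightarrow> 'g" where
  "alg_output A f =
     (case alg_card A f of enat n \<Rightarrow> out A (info_values A f n) | \<infinity> \<Rightarrow> out A [])"


section \<open>Randomized algorithms and minimal errors\<close>

definition randomized_algorithm ::
    "'f set \<Rightarrow> ('f \<Rightarrow> 'k) set \<Rightarrow> 'w measure \<Rightarrow> ('w \<Rightarrow> ('f, 'k, 'g::banach) det_alg) \<Rightarrow> bool" where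
  "randomized_algorithm F \<Lambda> M A \<longleftrightarrow>
     emeasure M (space M) = 1 \<and>
     (\<forall>\<omega>\<in>space M. det_algorithm \<Lambda> (A \<omega>)) \<and>
     (\<forall>f\<in>F. (\<lambda>\<omega>. alg_card (A \<omega>) f) \<in> M \<rightarrow>\<^sub>M count_space UNIV \<and>
            (\<lambda>\<omega>. alg_output (A \<omega>) f) \<in> borel_measurable M \<and>
            (\<exists>D. countable D \<and> (AE \<omega> in M. alg_output (A \<omega>) f \<in> closure D)))"

definition nonadaptive_randomized :: "'w measure \<Rightarrow> ('w \<Rightarrow> ('f, 'k, 'g) det_alg) \<Rightarrow> bool" where
  "nonadaptive_randomized M A \<longleftrightarrow> (\<forall>\<omega>\<in>space M. nonadaptive (A \<omega>))"

definition ran_cost :: "'f set \<Rightarrow> 'w measure \<Rightarrow> ('w \<Rightarrow> ('f, 'k, 'g) det_alg) \<Rightarrow> ennreal" where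
  "ran_cost F M A = (SUP f\<in>F. \<integral>\<^sup>+\<omega>. ennreal_of_enat (alg_card (A \<omega>) f) \<partial>M)"

definition ran_error ::
    "('f \<Rightarrow> 'g) \<Rightarrow> 'f set \<Rightarrow> 'w measure \<Rightarrow> ('w \<Rightarrow> ('f, 'k, 'g::banach) det_alg) \<Rightarrow> ennreal" where
  "ran_error S F M A = (SUP f\<in>F. \<integral>\<^sup>+\<omega>. ennreal (norm (S f - alg_output (A \<omega>) f)) \<partial>M)"

text \<open>
  The minimal errors range over randomized algorithms on all probability spaces. A definition can
  only quantify over measures on one type; here it is the type of deterministic algorithms. This
  is no restriction: transporting the measure along \<open>\<omega> \<mapsto> A\<^sub>\<omega>\<close> preserves card and output, see
  \<open>e_ran_le\<close> and \<open>e_ran_non_le\<close> below, where the sample space has an arbitrary type.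
\<close>

definition e_ran :: "('f \<Rightarrow> 'g::banach) \<Rightarrow> 'f set \<Rightarrow> ('f \<Rightarrow> 'k) set \<Rightarrow> nat \<Rightarrow> ennreal" where
  "e_ran S F \<Lambda> n =
     (INF (M, A) \<in> {(M :: ('f, 'k, 'g) det_alg measure, A).
        randomized_algorithm F \<Lambda> M A \<and> ran_cost F M A \<le> of_nat n}. ran_error S F M A)"

definition e_ran_non :: "('f \<Rightarrow> 'g::banach) \<Rightarrow> 'f set \<Rightarrow> ('f \<Rightarrow> 'k) set \<Rightarrow> nat \<Rightarrow> ennreal" where
  "e_ran_non S F \<Lambda> n =
     (INF (M, A) \<in> {(M :: ('f, 'k, 'g) det_alg measure, A).
        randomized_algorithm F \<Lambda> M A \<and> nonadaptive_randomized M A \<and> ran_cost F M A \<le> of_nat n}.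
      ran_error S F M A)"

lemma randomized_algorithm_transport:
  fixes M :: "'w measure" and A :: "'w \<Rightarrow> ('f, 'k, 'g::banach) det_alg"
  assumes "randomized_algorithm F \<Lambda> M A"
  obtains N :: "('f, 'k, 'g) det_alg measure"
  where "space N = A ` space M" "randomized_algorithm F \<Lambda> N id"
    "ran_cost F N id = ran_cost F M A" "\<And>S. ran_error S F N id = ran_error S F M A"
proof -
  define \<B> where "\<B> = {B. B \<subseteq> A ` space M \<and> A -` B \<inter> space M \<in> sets M}"
  have sa: "sigma_algebra (A ` space M) \<B>"
    unfolding sigma_algebra_iff2
  proof (intro conjI ballI allI impI)
    show "\<B> \<subseteq> Pow (A ` space M)" by (auto simp: \<B>_def)
    show "{} \<in> \<B>" by (auto simp: \<B>_def)
  next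
    fix B assume "B \<in> \<B>"
    moreover have "A -` (A ` space M - B) \<inter> space M = space M - (A -` B \<inter> space M)" by auto
    ultimately show "A ` space M - B \<in> \<B>" by (auto simp: \<B>_def)
  next
    fix B :: "nat \<Rightarrow> _" assume "range B \<subseteq> \<B>"
    then have "\<And>i. A -` B i \<inter> space M \<in> sets M" "(\<Union>i. B i) \<subseteq> A ` space M"
      by (auto simp: \<B>_def)
    moreover have "A -` (\<Union>i. B i) \<inter> space M = (\<Union>i. A -` B i \<inter> space M)" by auto
    ultimately show "(\<Union>i. B i) \<in> \<B>"
      unfolding \<B>_def by (simp only: mem_Collect_eq) (auto simp del: UN_simps)
  qed
  define N0 where "N0 = sigma (A ` space M) \<B>"
  have sp0: "space N0 = A ` space M"
    unfolding N0_def using sa by (simp add: sigma_algebra.space_measure_of_eq)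
  have se0: "sets N0 = \<B>"
    unfolding N0_def using sa by (simp add: sigma_algebra.sets_measure_of_eq)
  have A_meas: "A \<in> M \<rightarrow>\<^sub>M N0"
    by (rule measurableI) (auto simp: sp0 se0 \<B>_def)
  have lift: "g \<in> N0 \<rightarrow>\<^sub>M R" if g: "(\<lambda>\<omega>. g (A \<omega>)) \<in> M \<rightarrow>\<^sub>M R" for g and R :: "'r measure"
  proof (rule measurableI)
    show "g x \<in> space R" if "x \<in> space N0" for x
      using that g by (auto simp: sp0 dest: measurable_space)
    fix X assume "X \<in> sets R"
    with g have "(\<lambda>\<omega>. g (A \<omega>)) -` X \<inter> space M \<in> sets M" by (rule measurable_sets)
    moreover have "A -` (g -` X \<inter> space N0) \<inter> space M = (\<lambda>\<omega>. g (A \<omega>)) -` X \<inter> space M"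
      by (auto simp: sp0)
    ultimately show "g -` X \<inter> space N0 \<in> sets N0"
      by (auto simp: se0 \<B>_def sp0)
  qed
  define N where "N = distr M N0 A"
  have spN: "space N = A ` space M" by (simp add: N_def sp0)
  have cardM: "(\<lambda>a. alg_card a f) \<in> N0 \<rightarrow>\<^sub>M count_space UNIV"
    and outM: "(\<lambda>a. alg_output a f) \<in> borel_measurable N0" if "f \<in> F" for f
    using assms that unfolding randomized_algorithm_def by (auto intro!: lift)
  have cost: "(\<integral>\<^sup>+a. ennreal_of_enat (alg_card (id a) f) \<partial>N)
      = (\<integral>\<^sup>+\<omega>. ennreal_of_enat (alg_card (A \<omega>) f) \<partial>M)" if "f \<in> F" for f
    unfolding N_def id_apply using cardM[OF that] by (subst nn_integral_distr[OF A_meas]) auto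
  have err: "(\<integral>\<^sup>+a. ennreal (norm (S f - alg_output (id a) f)) \<partial>N)
      = (\<integral>\<^sup>+\<omega>. ennreal (norm (S f - alg_output (A \<omega>) f)) \<partial>M)" if "f \<in> F" for f S
  proof -
    have "(\<lambda>y. norm (S f - y)) \<in> borel_measurable borel"
      by (intro borel_measurable_continuous_onI continuous_intros)
    from measurable_compose[OF outM[OF that] this]
    have "(\<lambda>a. ennreal (norm (S f - alg_output a f))) \<in> borel_measurable N0"
      by measurable
    then show ?thesis
      unfolding N_def id_apply by (subst nn_integral_distr[OF A_meas]) auto
  qed
  have one: "emeasure N (space N) = 1"
  proof -
    have "A -` space N0 \<inter> space M = space M" by (auto simp: sp0)
    then show ?thesis
      using assms A_meas by (simp add: N_def emeasure_distr randomized_algorithm_def)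
  qed
  have "randomized_algorithm F \<Lambda> N id"
    unfolding randomized_algorithm_def
  proof (intro conjI ballI)
    show "emeasure N (space N) = 1" by (rule one)
    show "det_algorithm \<Lambda> (id a)" if "a \<in> space N" for a
      using that assms by (auto simp: spN randomized_algorithm_def)
  next
    fix f assume f: "f \<in> F"
    show "(\<lambda>a. alg_card (id a) f) \<in> N \<rightarrow>\<^sub>M count_space UNIV"
      using cardM[OF f] by (simp add: N_def)
    show "(\<lambda>a. alg_output (id a) f) \<in> borel_measurable N"
      using outM[OF f] by (simp add: N_def)
    obtain D where D: "countable D" "AE \<omega> in M. alg_output (A \<omega>) f \<in> closure D"
      using assms f unfolding randomized_algorithm_def by blast
    have "{a \<in> space N0. alg_output a f \<in> closure D} \<in> sets N0"
      using measurable_sets[OF outM[OF f], of "closure D"]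
      by (simp add: vimage_def Int_def conj_commute)
    then have "AE a in N. alg_output (id a) f \<in> closure D"
      unfolding N_def id_apply using D(2) by (subst AE_distr_iff[OF A_meas]) auto
    with D(1) show "\<exists>D. countable D \<and> (AE a in N. alg_output (id a) f \<in> closure D)" by blast
  qed
  with spN show thesis
    by (rule that)
      (auto simp only: ran_cost_def ran_error_def intro!: SUP_cong cost err)
qed

lemma e_ran_le:
  fixes M :: "'w measure" and A :: "'w \<Rightarrow> ('f, 'k, 'g::banach) det_alg"
  assumes "randomized_algorithm F \<Lambda> M A" "ran_cost F M A \<le> of_nat n"
  shows "e_ran S F \<Lambda> n \<le> ran_error S F M A"
proof -
  obtain N :: "('f, 'k, 'g) det_alg measure"
    where N: "randomized_algorithm F \<Lambda> N id" "ran_cost F N id = ran_cost F M A"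
      "ran_error S F N id = ran_error S F M A"
    using randomized_algorithm_transport[OF assms(1)] by metis
  have "e_ran S F \<Lambda> n \<le> ran_error S F N id"
    unfolding e_ran_def by (rule INF_lower2[of "(N, id)"]) (use N assms(2) in auto)
  with N(3) show ?thesis by simp
qed

lemma e_ran_non_le:
  fixes M :: "'w measure" and A :: "'w \<Rightarrow> ('f, 'k, 'g::banach) det_alg"
  assumes "randomized_algorithm F \<Lambda> M A" "nonadaptive_randomized M A"
    "ran_cost F M A \<le> of_nat n"
  shows "e_ran_non S F \<Lambda> n \<le> ran_error S F M A"
proof -
  obtain N :: "('f, 'k, 'g) det_alg measure"
    where N: "space N = A ` space M" "randomized_algorithm F \<Lambda> N id"
      "ran_cost F N id = ran_cost F M A" "ran_error S F N id = ran_error S F M A"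
    using randomized_algorithm_transport[OF assms(1)] by metis
  have "nonadaptive_randomized N id"
    using assms(2) N(1) by (auto simp: nonadaptive_randomized_def)
  then have "e_ran_non S F \<Lambda> n \<le> ran_error S F N id"
    unfolding e_ran_non_def by (intro INF_lower2[of "(N, id)"]) (use N assms(3) in auto)
  with N(4) show ?thesis by simp
qed


section \<open>Mean computation on mixed-norm spaces\<close>

definition recip :: "ereal \<Rightarrow> real" where
  "recip p = real_of_ereal (1 / p)"

lemma recip_simps: "recip \<infinity> = 0" "recip (ereal r) = 1 / r"
  by (auto simp: recip_def one_ereal_def divide_ereal_def field_simps)

definition Lp_norm :: "ereal \<Rightarrow> nat \<Rightarrow> (nat \<Rightarrow> 'a::real_normed_vector) \<Rightarrow> real" where
  "Lp_norm p N f =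
     (if p = \<infinity> then Max ((\<lambda>i. norm (f i)) ` {1..N})
      else (1 / real N * (\<Sum>i=1..N. norm (f i) powr real_of_ereal p)) powr recip p)"

definition mixed_norm ::
    "ereal \<Rightarrow> ereal \<Rightarrow> nat \<Rightarrow> nat \<Rightarrow> (nat \<times> nat \<Rightarrow> 'k::real_normed_vector) \<Rightarrow> real" where
  "mixed_norm p u N\<^sub>1 N\<^sub>2 f = Lp_norm p N\<^sub>1 (\<lambda>i. Lp_norm u N\<^sub>2 (\<lambda>j. f (i, j)))"

definition mixed_ball ::
    "ereal \<Rightarrow> ereal \<Rightarrow> nat \<Rightarrow> nat \<Rightarrow> (nat \<times> nat \<Rightarrow> 'k::real_normed_vector) set" where
  "mixed_ball p u N\<^sub>1 N\<^sub>2 =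
     {f \<in> extensional ({1..N\<^sub>1} \<times> {1..N\<^sub>2}). mixed_norm p u N\<^sub>1 N\<^sub>2 f \<le> 1}"

definition mean_op :: "nat \<Rightarrow> nat \<Rightarrow> (nat \<times> nat \<Rightarrow> 'k::real_normed_vector) \<Rightarrow> 'k" where
  "mean_op N\<^sub>1 N\<^sub>2 f = (1 / (real N\<^sub>1 * real N\<^sub>2)) *\<^sub>R (\<Sum>i=1..N\<^sub>1. \<Sum>j=1..N\<^sub>2. f (i, j))"

definition std_info :: "nat \<Rightarrow> nat \<Rightarrow> ((nat \<times> nat \<Rightarrow> 'k) \<Rightarrow> 'k) set" where
  "std_info N\<^sub>1 N\<^sub>2 = {(\<lambda>f. f (i, j)) |i j. i \<in> {1..N\<^sub>1} \<and> j \<in> {1..N\<^sub>2}}"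

text \<open>
  The scalar field is a type \<open>'k\<close> of class \<open>{real_normed_field, euclidean_space}\<close>. Both \<open>real\<close> and
  \<open>complex\<close> are instances, and up to isometric isomorphism they are the only ones: a
  finite-dimensional commutative field extension of the reals is \<open>\<real>\<close> or \<open>\<complex>\<close>, and the multiplicative
  norm is then the absolute value.
\<close>

definition mean_e_ran ::
    "'k::{real_normed_field, euclidean_space} itself
      \<Rightarrow> ereal \<Rightarrow> ereal \<Rightarrow> nat \<Rightarrow> nat \<Rightarrow> nat \<Rightarrow> ennreal" where
  "mean_e_ran TYPE('k) p u n N\<^sub>1 N\<^sub>2 =
     e_ran (mean_op N\<^sub>1 N\<^sub>2 :: (nat \<times> nat \<Rightarrow> 'k) \<Rightarrow> 'k) (mixed_ball p u N\<^sub>1 N\<^sub>2)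
       (std_info N\<^sub>1 N\<^sub>2 :: ((nat \<times> nat \<Rightarrow> 'k) \<Rightarrow> 'k) set) n"

definition mean_e_ran_non ::
    "'k::{real_normed_field, euclidean_space} itself
      \<Rightarrow> ereal \<Rightarrow> ereal \<Rightarrow> nat \<Rightarrow> nat \<Rightarrow> nat \<Rightarrow> ennreal" where
  "mean_e_ran_non TYPE('k) p u n N\<^sub>1 N\<^sub>2 =
     e_ran_non (mean_op N\<^sub>1 N\<^sub>2 :: (nat \<times> nat \<Rightarrow> 'k) \<Rightarrow> 'k) (mixed_ball p u N\<^sub>1 N\<^sub>2)
       (std_info N\<^sub>1 N\<^sub>2 :: ((nat \<times> nat \<Rightarrow> 'k) \<Rightarrow> 'k) set) n"

definition admissible :: "real \<Rightarrow> nat \<Rightarrow> (nat \<times> nat) set" where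
  "admissible c\<^sub>0 n =
     {(N\<^sub>1, N\<^sub>2). 1 \<le> N\<^sub>1 \<and> 1 \<le> N\<^sub>2 \<and> N\<^sub>1 \<le> n \<and> real n < c\<^sub>0 * real N\<^sub>1 * real N\<^sub>2}"

text \<open>\<open>c\<^sub>0\<close> is a constant with the property that defines \<open>c(0)\<close> for the given \<open>p\<close> and \<open>u\<close>.\<close>

definition is_c0 ::
    "'k::{real_normed_field, euclidean_space} itself \<Rightarrow> ereal \<Rightarrow> ereal \<Rightarrow> real \<Rightarrow> bool" where
  "is_c0 TYPE('k) p u c\<^sub>0 \<longleftrightarrow> 0 < c\<^sub>0 \<and> c\<^sub>0 < 1 \<and>
     (\<exists>a\<^sub>1>0. \<exists>a\<^sub>2>0. \<exists>a\<^sub>3>0. \<exists>a\<^sub>4>0. \<forall>n\<ge>1. \<forall>(N\<^sub>1, N\<^sub>2)\<in>admissible c\<^sub>0 n.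
        ennreal (a\<^sub>1 * real N\<^sub>1 powr (recip p - recip u) * real n powr (- 1 + recip u)
                 + a\<^sub>1 * real n powr (- 1 / 2))
          \<le> mean_e_ran TYPE('k) p u n N\<^sub>1 N\<^sub>2 \<and>
        mean_e_ran TYPE('k) p u n N\<^sub>1 N\<^sub>2
          \<le> ennreal (a\<^sub>2 * real N\<^sub>1 powr (recip p - recip u) * real n powr (- 1 + recip u)
                      * log 2 (real N\<^sub>1 + 1) powr (1 - recip u)
                    + a\<^sub>2 * real n powr (- 1 / 2) * log 2 (real N\<^sub>1 + 1) powr (1 / 2)) \<and>
        ennreal (a\<^sub>3 * real N\<^sub>1 powr (recip p - 1 / 2) * real n powr (- 1 / 2))
          \<le> mean_e_ran_non TYPE('k) p u n N\<^sub>1 N\<^sub>2 \<and>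
        mean_e_ran_non TYPE('k) p u n N\<^sub>1 N\<^sub>2
          \<le> ennreal (a\<^sub>4 * real N\<^sub>1 powr (recip p - 1 / 2) * real n powr (- 1 / 2)))"

definition gamma_ratio ::
    "'k::{real_normed_field, euclidean_space} itself
      \<Rightarrow> ereal \<Rightarrow> ereal \<Rightarrow> nat \<Rightarrow> nat \<Rightarrow> nat \<Rightarrow> ennreal" where
  "gamma_ratio TYPE('k) p u n N\<^sub>1 N\<^sub>2 =
     mean_e_ran_non TYPE('k) p u n N\<^sub>1 N\<^sub>2 / mean_e_ran TYPE('k) p u n N\<^sub>1 N\<^sub>2"

definition gamma_sup ::
    "'k::{real_normed_field, euclidean_space} itself
      \<Rightarrow> real \<Rightarrow> ereal \<Rightarrow> ereal \<Rightarrow> nat \<Rightarrow> ennreal" where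
  "gamma_sup TYPE('k) c\<^sub>0 p u n =
     (SUP (N\<^sub>1, N\<^sub>2) \<in> admissible c\<^sub>0 n. gamma_ratio TYPE('k) p u n N\<^sub>1 N\<^sub>2)"

definition gap_exponent :: "ereal \<Rightarrow> ereal \<Rightarrow> real" where
  "gap_exponent p u = (recip p - 1 / 2) * (1 / 2 - recip u) / (recip p - recip u)"

end

theory Submission
  imports Defs
begin

text \<open>
  Write \<open>P = 1/p\<close>, \<open>U = 1/u\<close>, so that \<open>U < 1/2 < P\<close>. The defining property of \<open>c\<^sub>0\<close> gives two-sided
  bounds for both minimal errors. Divided by \<open>n powr (-1/2)\<close>, the two terms that bound the adaptive
  error become the dimensionless quantity \<open>y = N\<^sub>1 powr (P - U) * n powr (U - 1/2)\<close> and \<open>1\<close>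
  (up to logarithms), while the non-adaptive error becomes
  \<open>N\<^sub>1 powr (P - 1/2) = y powr \<theta> * n powr g\<close>, where \<open>\<theta> = (P - 1/2) / (P - U)\<close> lies in \<open>(0, 1)\<close> and
  \<open>g\<close> is the gap exponent. Up to constants and logarithms the ratio of the errors is therefore
  \<open>y powr \<theta> / (1 + y) * n powr g\<close> (lemma \<open>gamma_ratio_bounds\<close>).

  The factor \<open>y powr \<theta> / (1 + y)\<close> never exceeds \<open>1\<close>, which gives the upper bounds. It is bounded
  below as long as \<open>y\<close> stays in a compact subset of the positive half-line. For the supremum
  over \<open>N\<^sub>1\<close> and \<open>N\<^sub>2\<close> this is achieved by taking \<open>N\<^sub>1\<close> close to \<open>n powr ((1/2 - U) / (P - U))\<close>, the
  value that makes \<open>y = 1\<close> (lemma \<open>balanced_admissible_pair\<close>), and \<open>N\<^sub>2\<close> so large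
  that the pair is admissible. In the extreme case \<open>p = 1\<close>, \<open>u = \<infinity>\<close> one has \<open>y = N\<^sub>1 / sqrt n\<close>, which the hypothesis on \<open>N\<^sub>1\<close> confines to
  \<open>[c\<^sub>3, c\<^sub>4]\<close>.

  Finally, \<open>g = a b / (a + b)\<close> with \<open>a = P - 1/2\<close> and \<open>b = 1/2 - U\<close> in \<open>(0, 1/2]\<close>. This is half the
  harmonic mean of \<open>a\<close> and \<open>b\<close>, hence at most \<open>1/4\<close>, with equality only for \<open>a = b = 1/2\<close>.
\<close>

section \<open>The gap exponent\<close>

lemma recip_bounds_low:
  fixes q :: ereal
  assumes "1 \<le> q" "q < 2"
  shows "1 / 2 < recip q" "recip q \<le> 1" "recip q = 1 \<longleftrightarrow> q = 1"
proof -
  obtain r where r: "q = ereal r"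
    using assms by (cases q) auto
  with assms have "1 \<le> r" "r < 2"
    by (metis one_ereal_def ereal_less_eq(3)) (metis r assms(2) numeral_eq_ereal less_ereal.simps(1))
  then show "1 / 2 < recip q" "recip q \<le> 1" "recip q = 1 \<longleftrightarrow> q = 1"
    unfolding r recip_simps by (auto simp: field_simps one_ereal_def)
qed

lemma recip_bounds_high:
  fixes v :: ereal
  assumes "2 < v"
  shows "recip v < 1 / 2" "0 \<le> recip v" "recip v = 0 \<longleftrightarrow> v = \<infinity>"
proof -
  have "recip v < 1 / 2 \<and> 0 \<le> recip v \<and> (recip v = 0 \<longleftrightarrow> v = \<infinity>)"
  proof (cases v)
    case (real r)
    with assms have "2 < r"
      by (metis numeral_eq_ereal less_ereal.simps(1))
    then show ?thesis
      unfolding real recip_simps by (auto simp: field_simps)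
  qed (use assms in \<open>auto simp: recip_simps\<close>)
  then show "recip v < 1 / 2" "0 \<le> recip v" "recip v = 0 \<longleftrightarrow> v = \<infinity>"
    by auto
qed

lemma product_over_sum_le_quarter:
  fixes a b :: real
  assumes "0 < a" "a \<le> 1 / 2" "0 < b" "b \<le> 1 / 2"
  shows "a * b / (a + b) \<le> 1 / 4" "a * b / (a + b) = 1 / 4 \<longleftrightarrow> a = 1 / 2 \<and> b = 1 / 2"
proof -
  have split: "a + b - 4 * (a * b) = a * (1 - 2 * b) + b * (1 - 2 * a)"
    by (simp add: algebra_simps)
  have nonneg: "0 \<le> a * (1 - 2 * b)" "0 \<le> b * (1 - 2 * a)"
    using assms by auto
  show "a * b / (a + b) \<le> 1 / 4"
    using add_nonneg_nonneg[OF nonneg] assms unfolding split[symmetric] by (simp add: divide_le_eq)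
  have "a * b / (a + b) = 1 / 4 \<longleftrightarrow> a + b - 4 * (a * b) = 0"
    using assms by (auto simp: field_simps)
  also have "\<dots> \<longleftrightarrow> a * (1 - 2 * b) = 0 \<and> b * (1 - 2 * a) = 0"
    unfolding split using nonneg by (rule add_nonneg_eq_0_iff)
  also have "\<dots> \<longleftrightarrow> a = 1 / 2 \<and> b = 1 / 2"
    using assms by auto
  finally show "a * b / (a + b) = 1 / 4 \<longleftrightarrow> a = 1 / 2 \<and> b = 1 / 2" .
qed

lemma gap_exponent_le_quarter:
  fixes q v :: ereal
  assumes "1 \<le> q" "q < 2" "2 < v"
  shows "gap_exponent q v \<le> 1 / 4" "gap_exponent q v = 1 / 4 \<longleftrightarrow> q = 1 \<and> v = \<infinity>"
proof -
  note q = recip_bounds_low[OF assms(1,2)] and v = recip_bounds_high[OF assms(3)]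
  have gap: "gap_exponent q v = (recip q - 1 / 2) * (1 / 2 - recip v)
      / ((recip q - 1 / 2) + (1 / 2 - recip v))"
    by (simp add: gap_exponent_def)
  have range: "0 < recip q - 1 / 2" "recip q - 1 / 2 \<le> 1 / 2"
    "0 < 1 / 2 - recip v" "1 / 2 - recip v \<le> 1 / 2"
    using q v by auto
  show "gap_exponent q v \<le> 1 / 4"
    unfolding gap by (rule product_over_sum_le_quarter(1)[OF range])
  show "gap_exponent q v = 1 / 4 \<longleftrightarrow> q = 1 \<and> v = \<infinity>"
    unfolding gap product_over_sum_le_quarter(2)[OF range] using q(3) v(3) by auto
qed


section \<open>The ratio of the errors in terms of the balance\<close>

text \<open>
  The quotient of the two terms \<open>x powr (P - U) * n powr (-1 + U)\<close> and \<open>n powr (-1/2)\<close> that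
  bound the adaptive error.
\<close>

definition balance :: "ereal \<Rightarrow> ereal \<Rightarrow> real \<Rightarrow> real \<Rightarrow> real" where
  "balance p u n x = x powr (recip p - recip u) * n powr (recip u - 1 / 2)"

definition balance_exponent :: "ereal \<Rightarrow> ereal \<Rightarrow> real" where
  "balance_exponent p u = (recip p - 1 / 2) / (recip p - recip u)"

lemma balance_pos: "0 < x \<Longrightarrow> 0 < n \<Longrightarrow> 0 < balance p u n x"
  by (simp add: balance_def)

lemma first_error_term_eq_balance:
  assumes "0 < n"
  shows "x powr (recip p - recip u) * n powr (- 1 + recip u) = n powr (- 1 / 2) * balance p u n x"
proof -
  have "n powr (- 1 + recip u) = n powr (- 1 / 2) * n powr (recip u - 1 / 2)"
    by (simp flip: powr_add)
  then show ?thesis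
    by (simp add: balance_def)
qed

text \<open>
  The balance exponent \<open>\<theta>\<close> is forced by matching the powers of \<open>x\<close>. The factor
  \<open>n powr ((1/2 - U) * \<theta>)\<close> that makes up for the powers of \<open>n\<close> is where the gap exponent comes from.
\<close>

lemma nonadaptive_term_eq_balance:
  assumes "recip u < recip p" "0 < x" "0 < n"
  shows "x powr (recip p - 1 / 2)
    = balance p u n x powr balance_exponent p u * n powr gap_exponent p u"
proof -
  have "(recip p - recip u) * balance_exponent p u = recip p - 1 / 2"
    and "(recip u - 1 / 2) * balance_exponent p u + gap_exponent p u = 0"
    using assms by (auto simp: balance_exponent_def gap_exponent_def field_simps)
  then show ?thesis
    using assms
    by (simp add: balance_def powr_mult powr_powr mult.assoc flip: powr_add)
qed

lemma powr_le_one_plus: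
  fixes y t :: real
  assumes "0 < y" "0 \<le> t" "t \<le> 1"
  shows "y powr t \<le> 1 + y"
proof (cases "y \<le> 1")
  case True
  then have "y powr t \<le> 1 powr t"
    using assms by (intro powr_mono2) auto
  with assms show ?thesis by simp
next
  case False
  then have "y powr t \<le> y powr 1"
    using assms by (intro powr_mono) auto
  with assms show ?thesis by simp
qed

lemma ennreal_divide_between:
  assumes "ennreal a \<le> X" "X \<le> ennreal b" "ennreal c \<le> Y" "Y \<le> ennreal d"
    and "0 \<le> a" "0 \<le> b" "0 < c" "0 < d"
  shows "ennreal (a / d) \<le> X / Y" "X / Y \<le> ennreal (b / c)"
proof -
  obtain x y where "X = ennreal x" "Y = ennreal y" "0 \<le> x" "0 \<le> y"
    using assms(2,4) by (metis ennreal_cases ennreal_less_top leD)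
  moreover from this have "a \<le> x" "x \<le> b" "c \<le> y" "y \<le> d"
    using assms by (auto simp: ennreal_le_iff)
  ultimately show "ennreal (a / d) \<le> X / Y" "X / Y \<le> ennreal (b / c)"
    using assms by (auto simp: divide_ennreal intro!: ennreal_leI frac_le)
qed

text \<open>
  Both logarithmic factors in the upper bound for the adaptive error are at most
  \<open>log 2 (n + 1) powr (1 - U)\<close>, since \<open>1 - U > 1/2\<close> and \<open>N\<^sub>1 \<le> n\<close>.
\<close>

lemma gamma_ratio_bounds:
  fixes p u :: ereal and c\<^sub>0 :: real
  assumes p: "1 / 2 < recip p" and u: "recip u < 1 / 2"
    and c0: "is_c0 TYPE('k::{real_normed_field, euclidean_space}) p u c\<^sub>0"
  obtains A B :: real where "0 < A" "0 < B"
    and "\<And>n N\<^sub>1 N\<^sub>2. 1 \<le> n \<Longrightarrow> (N\<^sub>1, N\<^sub>2) \<in> admissible c\<^sub>0 n \<Longrightarrow>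
      gamma_ratio TYPE('k) p u n N\<^sub>1 N\<^sub>2 \<le> ennreal (A * real n powr gap_exponent p u)"
    and "\<And>n N\<^sub>1 N\<^sub>2. 1 \<le> n \<Longrightarrow> (N\<^sub>1, N\<^sub>2) \<in> admissible c\<^sub>0 n \<Longrightarrow>
      ennreal (B * (balance p u n N\<^sub>1 powr balance_exponent p u / (1 + balance p u n N\<^sub>1))
          * log 2 (real n + 1) powr (recip u - 1) * real n powr gap_exponent p u)
        \<le> gamma_ratio TYPE('k) p u n N\<^sub>1 N\<^sub>2"
proof -
  from c0 obtain a\<^sub>1 a\<^sub>2 a\<^sub>3 a\<^sub>4 :: real
    where pos: "0 < a\<^sub>1" "0 < a\<^sub>2" "0 < a\<^sub>3" "0 < a\<^sub>4"
      and bounds: "\<forall>n\<ge>1. \<forall>(N\<^sub>1, N\<^sub>2)\<in>admissible c\<^sub>0 n.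
        ennreal (a\<^sub>1 * real N\<^sub>1 powr (recip p - recip u) * real n powr (- 1 + recip u)
                 + a\<^sub>1 * real n powr (- 1 / 2))
          \<le> mean_e_ran TYPE('k) p u n N\<^sub>1 N\<^sub>2 \<and>
        mean_e_ran TYPE('k) p u n N\<^sub>1 N\<^sub>2
          \<le> ennreal (a\<^sub>2 * real N\<^sub>1 powr (recip p - recip u) * real n powr (- 1 + recip u)
                      * log 2 (real N\<^sub>1 + 1) powr (1 - recip u)
                    + a\<^sub>2 * real n powr (- 1 / 2) * log 2 (real N\<^sub>1 + 1) powr (1 / 2)) \<and>
        ennreal (a\<^sub>3 * real N\<^sub>1 powr (recip p - 1 / 2) * real n powr (- 1 / 2))
          \<le> mean_e_ran_non TYPE('k) p u n N\<^sub>1 N\<^sub>2 \<and>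
        mean_e_ran_non TYPE('k) p u n N\<^sub>1 N\<^sub>2
          \<le> ennreal (a\<^sub>4 * real N\<^sub>1 powr (recip p - 1 / 2) * real n powr (- 1 / 2))"
    unfolding is_c0_def by blast
  define g where "g = gap_exponent p u"
  define t where "t = balance_exponent p u"
  have t: "0 \<le> t" "t \<le> 1"
    using p u by (auto simp: t_def balance_exponent_def field_simps)
  have both: "gamma_ratio TYPE('k) p u n N\<^sub>1 N\<^sub>2 \<le> ennreal (a\<^sub>4 / a\<^sub>1 * real n powr g) \<and>
      ennreal (a\<^sub>3 / a\<^sub>2 * (balance p u n N\<^sub>1 powr t / (1 + balance p u n N\<^sub>1))
          * log 2 (real n + 1) powr (recip u - 1) * real n powr g)
        \<le> gamma_ratio TYPE('k) p u n N\<^sub>1 N\<^sub>2"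
    if n: "1 \<le> n" and adm: "(N\<^sub>1, N\<^sub>2) \<in> admissible c\<^sub>0 n" for n N\<^sub>1 N\<^sub>2 :: nat
  proof -
    have N1: "1 \<le> N\<^sub>1" "N\<^sub>1 \<le> n"
      using adm by (auto simp: admissible_def)
    define y where "y = balance p u n N\<^sub>1"
    define s where "s = real n powr (- 1 / 2)"
    define G where "G = real n powr g"
    define L where "L = log 2 (real n + 1)"
    have y: "0 < y" and s: "0 < s" and G: "0 < G"
      using n N1 by (auto simp: y_def s_def G_def balance_pos)
    have l: "1 \<le> log 2 (real N\<^sub>1 + 1)" "log 2 (real N\<^sub>1 + 1) \<le> L"
      using N1 by (auto simp: L_def)
    then have L: "1 \<le> L"
      by linarith
    have non: "real N\<^sub>1 powr (recip p - 1 / 2) = y powr t * G"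
      unfolding y_def t_def G_def g_def
      by (rule nonadaptive_term_eq_balance) (use p u n N1 in auto)
    have ad: "real N\<^sub>1 powr (recip p - recip u) * real n powr (- 1 + recip u) = s * y"
      unfolding s_def y_def using n by (intro first_error_term_eq_balance) auto
    from bounds n adm have e:
      "ennreal (a\<^sub>1 * real N\<^sub>1 powr (recip p - recip u) * real n powr (- 1 + recip u)
          + a\<^sub>1 * real n powr (- 1 / 2)) \<le> mean_e_ran TYPE('k) p u n N\<^sub>1 N\<^sub>2"
      "mean_e_ran TYPE('k) p u n N\<^sub>1 N\<^sub>2
        \<le> ennreal (a\<^sub>2 * real N\<^sub>1 powr (recip p - recip u) * real n powr (- 1 + recip u)
                    * log 2 (real N\<^sub>1 + 1) powr (1 - recip u)
                  + a\<^sub>2 * real n powr (- 1 / 2) * log 2 (real N\<^sub>1 + 1) powr (1 / 2))"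
      "ennreal (a\<^sub>3 * real N\<^sub>1 powr (recip p - 1 / 2) * real n powr (- 1 / 2))
        \<le> mean_e_ran_non TYPE('k) p u n N\<^sub>1 N\<^sub>2"
      "mean_e_ran_non TYPE('k) p u n N\<^sub>1 N\<^sub>2
        \<le> ennreal (a\<^sub>4 * real N\<^sub>1 powr (recip p - 1 / 2) * real n powr (- 1 / 2))"
      by auto
    have lower_ad: "ennreal (a\<^sub>1 * s * (1 + y)) \<le> mean_e_ran TYPE('k) p u n N\<^sub>1 N\<^sub>2"
      using e(1) unfolding mult.assoc ad by (simp add: s_def algebra_simps)
    have logs: "log 2 (real N\<^sub>1 + 1) powr (1 - recip u) \<le> L powr (1 - recip u)"
      "log 2 (real N\<^sub>1 + 1) powr (1 / 2) \<le> L powr (1 - recip u)"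
    proof -
      show "log 2 (real N\<^sub>1 + 1) powr (1 - recip u) \<le> L powr (1 - recip u)"
        using l u by (intro powr_mono2) auto
      have "log 2 (real N\<^sub>1 + 1) powr (1 / 2) \<le> L powr (1 / 2)"
        using l by (intro powr_mono2) auto
      also have "\<dots> \<le> L powr (1 - recip u)"
        using L u by (intro powr_mono) auto
      finally show "log 2 (real N\<^sub>1 + 1) powr (1 / 2) \<le> L powr (1 - recip u)" .
    qed
    have "a\<^sub>2 * real N\<^sub>1 powr (recip p - recip u) * real n powr (- 1 + recip u)
            * log 2 (real N\<^sub>1 + 1) powr (1 - recip u)
          + a\<^sub>2 * real n powr (- 1 / 2) * log 2 (real N\<^sub>1 + 1) powr (1 / 2)
        = a\<^sub>2 * (s * y) * log 2 (real N\<^sub>1 + 1) powr (1 - recip u)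
          + a\<^sub>2 * s * log 2 (real N\<^sub>1 + 1) powr (1 / 2)"
      unfolding ad[symmetric] unfolding s_def by (simp only: mult.assoc)
    also have "\<dots> \<le> a\<^sub>2 * (s * y) * L powr (1 - recip u) + a\<^sub>2 * s * L powr (1 - recip u)"
      using pos s y logs by (intro add_mono mult_left_mono) auto
    also have "\<dots> = a\<^sub>2 * s * (1 + y) * L powr (1 - recip u)"
      by (simp add: algebra_simps)
    finally have upper_ad: "mean_e_ran TYPE('k) p u n N\<^sub>1 N\<^sub>2
        \<le> ennreal (a\<^sub>2 * s * (1 + y) * L powr (1 - recip u))"
      using e(2) ennreal_leI order_trans by blast
    have lower_non: "ennreal (a\<^sub>3 * (y powr t * G) * s) \<le> mean_e_ran_non TYPE('k) p u n N\<^sub>1 N\<^sub>2"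
      and upper_non: "mean_e_ran_non TYPE('k) p u n N\<^sub>1 N\<^sub>2 \<le> ennreal (a\<^sub>4 * (y powr t * G) * s)"
      using e(3,4) unfolding non s_def by auto
    have between:
      "ennreal (a\<^sub>3 * (y powr t * G) * s / (a\<^sub>2 * s * (1 + y) * L powr (1 - recip u)))
        \<le> gamma_ratio TYPE('k) p u n N\<^sub>1 N\<^sub>2"
      "gamma_ratio TYPE('k) p u n N\<^sub>1 N\<^sub>2
        \<le> ennreal (a\<^sub>4 * (y powr t * G) * s / (a\<^sub>1 * s * (1 + y)))"
      unfolding gamma_ratio_def
      by (rule ennreal_divide_between[OF lower_non upper_non lower_ad upper_ad];
          use pos s y G L in simp)+
    have "a\<^sub>4 * (y powr t * G) * s / (a\<^sub>1 * s * (1 + y)) = a\<^sub>4 / a\<^sub>1 * G * (y powr t / (1 + y))"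
      using s by simp
    also have "\<dots> \<le> a\<^sub>4 / a\<^sub>1 * G * 1"
      using pos y G powr_le_one_plus[OF y t] by (intro mult_left_mono) auto
    finally have "a\<^sub>4 * (y powr t * G) * s / (a\<^sub>1 * s * (1 + y)) \<le> a\<^sub>4 / a\<^sub>1 * G"
      by simp
    moreover have "a\<^sub>3 * (y powr t * G) * s / (a\<^sub>2 * s * (1 + y) * L powr (1 - recip u))
        = a\<^sub>3 / a\<^sub>2 * (y powr t / (1 + y)) * L powr (recip u - 1) * G"
    proof -
      have "L powr (recip u - 1) = inverse (L powr (1 - recip u))"
        by (simp flip: powr_minus)
      then show ?thesis
        using s by (simp add: divide_inverse ac_simps)
    qed
    ultimately show ?thesis
      using between ennreal_leI order_trans
      unfolding y_def[symmetric] G_def[symmetric] L_def[symmetric] by metis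
  qed
  show thesis
  proof (rule that)
    show "0 < a\<^sub>4 / a\<^sub>1" "0 < a\<^sub>3 / a\<^sub>2"
      using pos by auto
  qed (use both in \<open>auto simp: g_def t_def\<close>)
qed


section \<open>Admissible pairs of balanced size\<close>

text \<open>
  Taking \<open>N\<^sub>1 = n powr ((1/2 - U) / (P - U))\<close> would give balance \<open>1\<close>. This power is at least
  \<open>1\<close>, so rounding it down loses at most a factor \<open>2\<close> in \<open>N\<^sub>1\<close>, and also in the
  balance, as \<open>P - U \<le> 1\<close>. The exponent is at most \<open>1\<close>, so \<open>N\<^sub>1 \<le> n\<close>.
\<close>

lemma balanced_admissible_pair:
  fixes p u :: ereal and c\<^sub>0 :: real and n :: nat
  assumes p: "1 / 2 < recip p" "recip p \<le> 1" and u: "0 \<le> recip u" "recip u < 1 / 2"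
    and "0 < c\<^sub>0" and n: "1 \<le> n"
  obtains N\<^sub>1 N\<^sub>2 where "(N\<^sub>1, N\<^sub>2) \<in> admissible c\<^sub>0 n"
    "1 / 2 \<le> balance p u n N\<^sub>1" "balance p u n N\<^sub>1 \<le> 1"
proof -
  define D where "D = recip p - recip u"
  have D: "0 < D" "D \<le> 1"
    using p u by (auto simp: D_def)
  define a where "a = (1 / 2 - recip u) / D"
  have a: "0 \<le> a" "a \<le> 1" "a * D + (recip u - 1 / 2) = 0"
    using p u D by (auto simp: a_def D_def field_simps)
  define x where "x = real n powr a"
  define N\<^sub>1 where "N\<^sub>1 = nat \<lfloor>x\<rfloor>"
  have "1 \<le> x"
    unfolding x_def using n a by (simp add: ge_one_powr_ge_zero)
  then have "x - 1 < real N\<^sub>1" and N1: "1 \<le> N\<^sub>1" "real N\<^sub>1 \<le> x"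
    unfolding N\<^sub>1_def by linarith+
  then have half: "x / 2 \<le> real N\<^sub>1"
    by linarith
  have "x \<le> real n powr 1"
    unfolding x_def using n a by (intro powr_mono) auto
  with N1 n have "N\<^sub>1 \<le> n"
    by simp
  obtain N\<^sub>2 where N2: "real n / (c\<^sub>0 * real N\<^sub>1) < real N\<^sub>2"
    using reals_Archimedean2 by blast
  have "0 < real N\<^sub>2"
    by (rule order.strict_trans1[OF _ N2]) (use \<open>0 < c\<^sub>0\<close> in simp)
  with N2 N1 \<open>N\<^sub>1 \<le> n\<close> \<open>0 < c\<^sub>0\<close> have adm: "(N\<^sub>1, N\<^sub>2) \<in> admissible c\<^sub>0 n"
    by (auto simp: admissible_def field_simps)
  have balanced: "x powr D * real n powr (recip u - 1 / 2) = 1"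
    unfolding x_def powr_powr using n a(3) by (simp flip: powr_add)
  have "balance p u n N\<^sub>1 \<le> x powr D * real n powr (recip u - 1 / 2)"
    unfolding balance_def D_def[symmetric]
    using N1 D by (intro mult_right_mono powr_mono2) auto
  moreover have "1 / 2 \<le> balance p u n N\<^sub>1"
  proof -
    have "(1 / 2 :: real) powr 1 \<le> (1 / 2) powr D"
      using D by (intro powr_mono') auto
    then have "1 / 2 \<le> (1 / 2) powr D * (x powr D * real n powr (recip u - 1 / 2))"
      unfolding balanced by simp
    also have "\<dots> = (1 / 2 * x) powr D * real n powr (recip u - 1 / 2)"
      using \<open>1 \<le> x\<close> by (simp only: powr_mult mult.assoc)
    also have "\<dots> \<le> balance p u n N\<^sub>1"
      unfolding balance_def D_def[symmetric]
      using half D \<open>1 \<le> x\<close> by (intro mult_right_mono powr_mono2) auto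
    finally show ?thesis .
  qed
  ultimately show thesis
    using that adm balanced by auto
qed

text \<open>
  The condition on \<open>c\<^sub>3\<close> says \<open>c\<^sub>0 * c\<^sub>3\<^sup>2 > 1\<close>, so that \<open>c\<^sub>0 * N\<^sub>1 * N\<^sub>2\<close> exceeds \<open>n\<close> even at the lower
  ends of the ranges of \<open>N\<^sub>1\<close> and \<open>N\<^sub>2\<close>. The condition on \<open>c\<^sub>4\<close> gives \<open>N\<^sub>1 \<le> c\<^sub>4 * sqrt n \<le> n\<close>.
\<close>

lemma admissible_of_order_sqrt:
  fixes c\<^sub>0 c\<^sub>3 c\<^sub>4 :: real and n N\<^sub>1 N\<^sub>2 :: nat
  assumes "0 < c\<^sub>0" and c3: "c\<^sub>0 powr (- 1 / 2) < c\<^sub>3"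
    and n: "1 \<le> n" "c\<^sub>4\<^sup>2 \<le> real n" and "1 \<le> N\<^sub>1" "1 \<le> N\<^sub>2"
    and N1: "c\<^sub>3 * sqrt n \<le> real N\<^sub>1" "real N\<^sub>1 \<le> c\<^sub>4 * sqrt n" and N2: "c\<^sub>3 * sqrt n \<le> real N\<^sub>2"
  shows "(N\<^sub>1, N\<^sub>2) \<in> admissible c\<^sub>0 n"
proof -
  have "0 < c\<^sub>3"
    using c3 by (rule order.strict_trans1[rotated]) simp
  have "c\<^sub>4 \<le> sqrt n"
    using n by (simp add: real_le_rsqrt)
  then have "c\<^sub>4 * sqrt n \<le> sqrt n * sqrt n"
    by (intro mult_right_mono) auto
  with N1 have "N\<^sub>1 \<le> n"
    by simp
  have "1 / c\<^sub>0 = (c\<^sub>0 powr (- 1 / 2))\<^sup>2"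
    using \<open>0 < c\<^sub>0\<close> by (simp add: power2_eq_square powr_minus_divide flip: powr_add)
  also have "\<dots> < c\<^sub>3\<^sup>2"
    using c3 by (intro power_strict_mono) auto
  finally have "1 < c\<^sub>0 * c\<^sub>3\<^sup>2"
    using \<open>0 < c\<^sub>0\<close> by (simp add: field_simps)
  then have "real n < c\<^sub>0 * c\<^sub>3\<^sup>2 * real n"
    using n by simp
  also have "\<dots> = c\<^sub>0 * ((c\<^sub>3 * sqrt n) * (c\<^sub>3 * sqrt n))"
    by (simp add: power2_eq_square)
  also have "\<dots> \<le> c\<^sub>0 * (real N\<^sub>1 * real N\<^sub>2)"
    using N1 N2 \<open>0 < c\<^sub>0\<close> \<open>0 < c\<^sub>3\<close> by (intro mult_left_mono mult_mono) auto
  finally show ?thesis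
    using assms \<open>N\<^sub>1 \<le> n\<close> by (auto simp: admissible_def mult.assoc)
qed


section \<open>The gap between adaptive and non-adaptive algorithms\<close>

theorem corollary4p5:
  fixes p u :: ereal and c\<^sub>0 :: real
  assumes "1 \<le> p" and "p < 2" and "2 < u"
    and "is_c0 TYPE('k::{real_normed_field, euclidean_space}) p u c\<^sub>0"
  shows
    "(\<exists>c\<^sub>1>0. \<exists>c\<^sub>2>0. \<forall>n::nat. n \<ge> 1 \<longrightarrow>
        ennreal (c\<^sub>1 * log 2 (real n + 1) powr (recip u - 1) * real n powr gap_exponent p u)
          \<le> gamma_sup TYPE('k) c\<^sub>0 p u n \<and>
        gamma_sup TYPE('k) c\<^sub>0 p u n \<le> ennreal (c\<^sub>2 * real n powr gap_exponent p u))
     \<and> (\<forall>q v :: ereal. 1 \<le> q \<and> q < 2 \<and> 2 < v \<longrightarrow>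
          gap_exponent q v \<le> 1 / 4 \<and> (gap_exponent q v = 1 / 4 \<longleftrightarrow> q = 1 \<and> v = \<infinity>))
     \<and> (p = 1 \<and> u = \<infinity> \<longrightarrow>
          (\<forall>c\<^sub>3 c\<^sub>4 :: real. c\<^sub>0 powr (- 1 / 2) < c\<^sub>3 \<and> c\<^sub>3 < c\<^sub>4 \<longrightarrow>
            (\<exists>c\<^sub>5>0. \<exists>c\<^sub>6>0. \<forall>n N\<^sub>1 N\<^sub>2 :: nat.
               n \<ge> 1 \<and> real n \<ge> c\<^sub>4\<^sup>2 \<and> N\<^sub>1 \<ge> 1 \<and> N\<^sub>2 \<ge> 1 \<and>
               real N\<^sub>1 \<in> {c\<^sub>3 * real n powr (1 / 2) .. c\<^sub>4 * real n powr (1 / 2)} \<and>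
               real N\<^sub>2 \<in> {c\<^sub>3 * real n powr (1 / 2) .. c\<^sub>4 * real n powr (1 / 2)} \<longrightarrow>
               ennreal (c\<^sub>5 * log 2 (real n + 1) powr (- 1) * real n powr (1 / 4))
                 \<le> mean_e_ran_non TYPE('k) 1 \<infinity> n N\<^sub>1 N\<^sub>2 / mean_e_ran TYPE('k) 1 \<infinity> n N\<^sub>1 N\<^sub>2 \<and>
               mean_e_ran_non TYPE('k) 1 \<infinity> n N\<^sub>1 N\<^sub>2 / mean_e_ran TYPE('k) 1 \<infinity> n N\<^sub>1 N\<^sub>2
                 \<le> ennreal (c\<^sub>6 * real n powr (1 / 4)))))"
proof (intro conjI)
  note p = recip_bounds_low[OF assms(1,2)] and u = recip_bounds_high[OF assms(3)]
  have c0: "0 < c\<^sub>0"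
    using assms(4) by (simp add: is_c0_def)
  obtain A B :: real where A: "0 < A" and B: "0 < B"
    and upper: "\<And>n N\<^sub>1 N\<^sub>2. 1 \<le> n \<Longrightarrow> (N\<^sub>1, N\<^sub>2) \<in> admissible c\<^sub>0 n \<Longrightarrow>
      gamma_ratio TYPE('k) p u n N\<^sub>1 N\<^sub>2 \<le> ennreal (A * real n powr gap_exponent p u)"
    and lower: "\<And>n N\<^sub>1 N\<^sub>2. 1 \<le> n \<Longrightarrow> (N\<^sub>1, N\<^sub>2) \<in> admissible c\<^sub>0 n \<Longrightarrow>
      ennreal (B * (balance p u n N\<^sub>1 powr balance_exponent p u / (1 + balance p u n N\<^sub>1))
          * log 2 (real n + 1) powr (recip u - 1) * real n powr gap_exponent p u)
        \<le> gamma_ratio TYPE('k) p u n N\<^sub>1 N\<^sub>2"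
    by (rule gamma_ratio_bounds[OF p(1) u(1) assms(4)]) (rule that; blast)
  have t: "0 \<le> balance_exponent p u"
    using p u by (simp add: balance_exponent_def)
  have lower': "ennreal (B * (a powr balance_exponent p u / (1 + b))
          * log 2 (real n + 1) powr (recip u - 1) * real n powr gap_exponent p u)
        \<le> gamma_ratio TYPE('k) p u n N\<^sub>1 N\<^sub>2"
    if "1 \<le> n" "(N\<^sub>1, N\<^sub>2) \<in> admissible c\<^sub>0 n"
      "0 < a" "a \<le> balance p u n N\<^sub>1" "balance p u n N\<^sub>1 \<le> b"
    for a b :: real and n N\<^sub>1 N\<^sub>2 :: nat
  proof (rule order_trans[OF ennreal_leI lower[OF that(1,2)]])
    have "a powr balance_exponent p u / (1 + b)
        \<le> balance p u n N\<^sub>1 powr balance_exponent p u / (1 + balance p u n N\<^sub>1)"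
      using that t by (intro frac_le powr_mono2) auto
    then show "B * (a powr balance_exponent p u / (1 + b))
          * log 2 (real n + 1) powr (recip u - 1) * real n powr gap_exponent p u
        \<le> B * (balance p u n N\<^sub>1 powr balance_exponent p u / (1 + balance p u n N\<^sub>1))
          * log 2 (real n + 1) powr (recip u - 1) * real n powr gap_exponent p u"
      using B by (intro mult_right_mono mult_left_mono) auto
  qed

  \<comment> \<open>The balance of the pair from \<open>balanced_admissible_pair\<close> lies in \<open>[1/2, 1]\<close>.\<close>
  define c\<^sub>1 where "c\<^sub>1 = B * ((1 / 2) powr balance_exponent p u / (1 + 1))"
  have "0 < c\<^sub>1"
    using B by (simp add: c\<^sub>1_def)
  moreover have "ennreal (c\<^sub>1 * log 2 (real n + 1) powr (recip u - 1) * real n powr gap_exponent p u)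
          \<le> gamma_sup TYPE('k) c\<^sub>0 p u n"
    if n: "1 \<le> n" for n :: nat
  proof -
    obtain N\<^sub>1 N\<^sub>2 where N: "(N\<^sub>1, N\<^sub>2) \<in> admissible c\<^sub>0 n"
      "1 / 2 \<le> balance p u n N\<^sub>1" "balance p u n N\<^sub>1 \<le> 1"
      using balanced_admissible_pair[OF p(1,2) u(2,1) c0 n] by metis
    show ?thesis
      unfolding gamma_sup_def
      by (rule SUP_upper2[OF N(1)]) (use lower'[OF n N(1) _ N(2,3)] in \<open>simp add: c\<^sub>1_def\<close>)
  qed
  moreover have "gamma_sup TYPE('k) c\<^sub>0 p u n \<le> ennreal (A * real n powr gap_exponent p u)"
    if "1 \<le> n" for n :: nat
    unfolding gamma_sup_def using upper[OF that] by (auto intro!: SUP_least)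
  ultimately show "\<exists>c\<^sub>1>0. \<exists>c\<^sub>2>0. \<forall>n::nat. n \<ge> 1 \<longrightarrow>
        ennreal (c\<^sub>1 * log 2 (real n + 1) powr (recip u - 1) * real n powr gap_exponent p u)
          \<le> gamma_sup TYPE('k) c\<^sub>0 p u n \<and>
        gamma_sup TYPE('k) c\<^sub>0 p u n \<le> ennreal (c\<^sub>2 * real n powr gap_exponent p u)"
    using A by blast

  show "\<forall>q v :: ereal. 1 \<le> q \<and> q < 2 \<and> 2 < v \<longrightarrow>
          gap_exponent q v \<le> 1 / 4 \<and> (gap_exponent q v = 1 / 4 \<longleftrightarrow> q = 1 \<and> v = \<infinity>)"
    using gap_exponent_le_quarter by blast

  show "p = 1 \<and> u = \<infinity> \<longrightarrow>
          (\<forall>c\<^sub>3 c\<^sub>4 :: real. c\<^sub>0 powr (- 1 / 2) < c\<^sub>3 \<and> c\<^sub>3 < c\<^sub>4 \<longrightarrow>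
            (\<exists>c\<^sub>5>0. \<exists>c\<^sub>6>0. \<forall>n N\<^sub>1 N\<^sub>2 :: nat.
               n \<ge> 1 \<and> real n \<ge> c\<^sub>4\<^sup>2 \<and> N\<^sub>1 \<ge> 1 \<and> N\<^sub>2 \<ge> 1 \<and>
               real N\<^sub>1 \<in> {c\<^sub>3 * real n powr (1 / 2) .. c\<^sub>4 * real n powr (1 / 2)} \<and>
               real N\<^sub>2 \<in> {c\<^sub>3 * real n powr (1 / 2) .. c\<^sub>4 * real n powr (1 / 2)} \<longrightarrow>
               ennreal (c\<^sub>5 * log 2 (real n + 1) powr (- 1) * real n powr (1 / 4))
                 \<le> mean_e_ran_non TYPE('k) 1 \<infinity> n N\<^sub>1 N\<^sub>2 / mean_e_ran TYPE('k) 1 \<infinity> n N\<^sub>1 N\<^sub>2 \<and>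
               mean_e_ran_non TYPE('k) 1 \<infinity> n N\<^sub>1 N\<^sub>2 / mean_e_ran TYPE('k) 1 \<infinity> n N\<^sub>1 N\<^sub>2
                 \<le> ennreal (c\<^sub>6 * real n powr (1 / 4))))"
  proof (intro impI allI; (elim conjE)?)
    fix c\<^sub>3 c\<^sub>4 :: real
    assume pu: "p = 1" "u = \<infinity>" and c3: "c\<^sub>0 powr (- 1 / 2) < c\<^sub>3" and "c\<^sub>3 < c\<^sub>4"
    have "0 < c\<^sub>3"
      using c3 by (rule order.strict_trans1[rotated]) simp
    have P: "recip p = 1" and U: "recip u = 0" and gap: "gap_exponent p u = 1 / 4"
      using p(3) u(3) gap_exponent_le_quarter(2)[OF assms(1-3)] pu by auto
    define c\<^sub>5 where "c\<^sub>5 = B * (c\<^sub>3 powr balance_exponent p u / (1 + c\<^sub>4))"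
    have "0 < c\<^sub>5"
      using B \<open>0 < c\<^sub>3\<close> \<open>c\<^sub>3 < c\<^sub>4\<close> by (simp add: c\<^sub>5_def)
    moreover have "ennreal (c\<^sub>5 * log 2 (real n + 1) powr (- 1) * real n powr (1 / 4))
          \<le> mean_e_ran_non TYPE('k) 1 \<infinity> n N\<^sub>1 N\<^sub>2 / mean_e_ran TYPE('k) 1 \<infinity> n N\<^sub>1 N\<^sub>2 \<and>
        mean_e_ran_non TYPE('k) 1 \<infinity> n N\<^sub>1 N\<^sub>2 / mean_e_ran TYPE('k) 1 \<infinity> n N\<^sub>1 N\<^sub>2
          \<le> ennreal (A * real n powr (1 / 4))"
      if n: "n \<ge> 1" "real n \<ge> c\<^sub>4\<^sup>2" and N: "N\<^sub>1 \<ge> 1" "N\<^sub>2 \<ge> 1"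
        and "real N\<^sub>1 \<in> {c\<^sub>3 * real n powr (1 / 2) .. c\<^sub>4 * real n powr (1 / 2)}"
        and "real N\<^sub>2 \<in> {c\<^sub>3 * real n powr (1 / 2) .. c\<^sub>4 * real n powr (1 / 2)}"
      for n N\<^sub>1 N\<^sub>2 :: nat
    proof -
      have N1: "c\<^sub>3 * sqrt n \<le> real N\<^sub>1" "real N\<^sub>1 \<le> c\<^sub>4 * sqrt n" and N2: "c\<^sub>3 * sqrt n \<le> real N\<^sub>2"
        using that by (auto simp: powr_half_sqrt)
      have adm: "(N\<^sub>1, N\<^sub>2) \<in> admissible c\<^sub>0 n"
        by (rule admissible_of_order_sqrt[OF c0 c3 n N N1 N2])
      have balance: "balance p u n N\<^sub>1 = real N\<^sub>1 / sqrt n"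
        using n N by (simp add: balance_def P U powr_minus_divide powr_half_sqrt)
      have "c\<^sub>3 \<le> balance p u n N\<^sub>1" "balance p u n N\<^sub>1 \<le> c\<^sub>4"
        unfolding balance using N1 n by (auto simp: pos_le_divide_eq pos_divide_le_eq)
      from lower'[OF n(1) adm \<open>0 < c\<^sub>3\<close> this] upper[OF n(1) adm] show ?thesis
        unfolding gamma_ratio_def gap U unfolding pu c\<^sub>5_def by simp
    qed
    ultimately show "\<exists>c\<^sub>5>0. \<exists>c\<^sub>6>0. \<forall>n N\<^sub>1 N\<^sub>2 :: nat.
               n \<ge> 1 \<and> real n \<ge> c\<^sub>4\<^sup>2 \<and> N\<^sub>1 \<ge> 1 \<and> N\<^sub>2 \<ge> 1 \<and>
               real N\<^sub>1 \<in> {c\<^sub>3 * real n powr (1 / 2) .. c\<^sub>4 * real n powr (1 / 2)} \<and>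
               real N\<^sub>2 \<in> {c\<^sub>3 * real n powr (1 / 2) .. c\<^sub>4 * real n powr (1 / 2)} \<longrightarrow>
               ennreal (c\<^sub>5 * log 2 (real n + 1) powr (- 1) * real n powr (1 / 4))
                 \<le> mean_e_ran_non TYPE('k) 1 \<infinity> n N\<^sub>1 N\<^sub>2 / mean_e_ran TYPE('k) 1 \<infinity> n N\<^sub>1 N\<^sub>2 \<and>
               mean_e_ran_non TYPE('k) 1 \<infinity> n N\<^sub>1 N\<^sub>2 / mean_e_ran TYPE('k) 1 \<infinity> n N\<^sub>1 N\<^sub>2
                 \<le> ennreal (c\<^sub>6 * real n powr (1 / 4))"
      using A by blast
  qed
qed

end
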